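(* Let $n$ be a positive integer and $0\le k\le n$. Let $\mathrm{RInc}_k(2\times n)$ be the set of $2\times n$ arrays $T=(T_{i,j})_{1\le i\le 2,\,1\le j\le n}$ of positive integers such that each row is strictly increasing from left to right, each column is weakly increasing from top to bottom ($T_{1,j}\le T_{2,j}$), and the set of entries of $T$ is exactly $\{1,2,\ldots,2n-k\}$. Then \[ \sum_{T\in \mathrm{RInc}_k(2\times n)} q^{\mathrm{maj}(T)}=\frac{q^{\,n+k(k-3)/2}}{[n-k+1]}\begin{bmatrix}2n-k\\ k\end{bmatrix}\begin{bmatrix}2n-2k\\ n-k\end{bmatrix}. \]
   Context: Rows are numbered from top (row 1) to bottom (row 2). For such a two-row array $T$, an integer $i$ is a descent of $T$ if $i$ occurs in row 1 and $i+1$ occurs in row 2; $D(T)$ is the set of descents and $\mathrm{maj}(T)=\sum_{i\in D(T)} i$. Here $[m]=1+q+\cdots+q^{m-1}$, $[m]!=[1][2]\cdots[m]$, and $\begin{bmatrix}a\\ b\end{bmatrix}=\frac{[a]!}{[b]![a-b]!}$ is the $q$-binomial coefficient. *)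

theory Defs
  imports "HOL-Library.FuncSet" "HOL-Computational_Algebra.Computational_Algebra"
begin

text \<open>
  A two-row array is a function on the index pairs (row, column); arrays are taken to be
  \<^const>\<open>undefined\<close> off the index set, so that distinct arrays correspond to distinct functions.
\<close>

definition cells :: "nat \<Rightarrow> (nat \<times> nat) set" where
  "cells n = {1..2} \<times> {1..n}"

definition RInc :: "nat \<Rightarrow> nat \<Rightarrow> (nat \<times> nat \<Rightarrow> nat) set" where
  "RInc k n = {T \<in> cells n \<rightarrow>\<^sub>E {1..}.
     (\<forall>i\<in>{1..2}. strict_mono_on {1..n} (\<lambda>j. T (i, j))) \<and>
     (\<forall>j\<in>{1..n}. T (1, j) \<le> T (2, j)) \<and>
     T ` cells n = {1..2 * n - k}}"

definition descents :: "nat \<Rightarrow> (nat \<times> nat \<Rightarrow> nat) \<Rightarrow> nat set" where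
  "descents n T = {i. (\<exists>j\<in>{1..n}. T (1, j) = i) \<and> (\<exists>j\<in>{1..n}. T (2, j) = i + 1)}"

definition maj :: "nat \<Rightarrow> (nat \<times> nat \<Rightarrow> nat) \<Rightarrow> nat" where
  "maj n T = \<Sum>(descents n T)"

definition qnum :: "'a::field \<Rightarrow> nat \<Rightarrow> 'a" where
  "qnum q m = (\<Sum>i<m. q ^ i)"

definition qfact :: "'a::field \<Rightarrow> nat \<Rightarrow> 'a" where
  "qfact q m = (\<Prod>i=1..m. qnum q i)"

definition qbinom :: "'a::field \<Rightarrow> nat \<Rightarrow> nat \<Rightarrow> 'a" where
  "qbinom q a b = qfact q a / (qfact q b * qfact q (a - b))"

text \<open>The indeterminate, as an element of the field of rational functions in one variable.\<close>

definition qvar :: "int poly fract" where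
  "qvar = to_fract [:0, 1:]"

lemma finite_RInc: "finite (RInc k n)"
proof (rule finite_subset)
  show "RInc k n \<subseteq> cells n \<rightarrow>\<^sub>E {1..2 * n - k}"
  proof
    fix T assume "T \<in> RInc k n"
    then have T: "T \<in> extensional (cells n)" "T ` cells n = {1..2 * n - k}"
      by (simp_all add: RInc_def PiE_def)
    from T(2) have "T \<in> cells n \<rightarrow> {1..2 * n - k}" by blast
    with T(1) show "T \<in> cells n \<rightarrow>\<^sub>E {1..2 * n - k}" by (simp add: PiE_def)
  qed
  show "finite (cells n \<rightarrow>\<^sub>E {1..2 * n - k})"
    by (rule finite_PiE) (auto simp: cells_def)
qed

lemma finite_descents: "finite (descents n T)"
proof (rule finite_subset)
  show "descents n T \<subseteq> (\<lambda>j. T (1, j)) ` {1..n}"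
    unfolding descents_def by auto
qed simp

end

theory Submission
  imports Defs
begin

text \<open>
  An array is determined by its two row sets \<open>A\<close>, \<open>B\<close>, and the column condition says that \<open>A\<close>
  dominates \<open>B\<close> on every initial segment. So arrays are ballot words in three letters: \<open>a\<close> entries
  only in row 1, \<open>b\<close> only in row 2 and \<open>h\<close> in both. Deleting the largest entry \<open>N\<close> gives a
  recurrence, because appending a new entry to row 2 adds \<open>N\<close> to the major index exactly when
  \<open>N \<in> A\<close>, whether or not the new entry also lies in row 1. Without the ballot condition the
  recurrence is solved by \<open>M a b h = q ^ (h choose 2) [a + b + h]! / ([a]! [b]! [h]!)\<close>.
  The recurrence is linear with coefficients depending only on \<open>N\<close>, so \<open>M a b h - M (a + 1) (b - 1) h\<close>
  solves it too; as \<open>M\<close> is symmetric in \<open>a\<close> and \<open>b\<close>, the difference vanishes on the ballot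
  boundary \<open>b = a + 1\<close>.
\<close>

section \<open>Pairs of row sets and their generating sums\<close>

text \<open>By inclusion-exclusion the three cardinalities force \<open>A \<inter> B\<close> to have
  \<open>h\<close> elements, so \<open>a\<close> and \<open>b\<close> count the entries lying only
  in row 1 and only in row 2.\<close>

definition lattice_pairs :: "nat \<Rightarrow> nat \<Rightarrow> nat \<Rightarrow> (nat set \<times> nat set) set" where
  "lattice_pairs a b h = {(A, B). A \<union> B = {1..a + b + h} \<and> card A = a + h \<and> card B = b + h \<and>
     (\<forall>v. card (B \<inter> {..v}) \<le> card (A \<inter> {..v}))}"

definition pair_maj :: "nat set \<Rightarrow> nat set \<Rightarrow> nat" where
  "pair_maj A B = \<Sum>{i \<in> A. Suc i \<in> B}"

definition maj_sum :: "'a::field \<Rightarrow> nat \<Rightarrow> nat \<Rightarrow> nat \<Rightarrow> 'a" where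
  "maj_sum q a b h = (\<Sum>(A, B)\<in>lattice_pairs a b h. q ^ pair_maj A B)"

text \<open>The exponent is the major index after appending a new largest entry to row 2.\<close>

definition ext_maj_sum :: "'a::field \<Rightarrow> nat \<Rightarrow> nat \<Rightarrow> nat \<Rightarrow> 'a" where
  "ext_maj_sum q a b h = (\<Sum>(A, B)\<in>lattice_pairs a b h.
     q ^ (pair_maj A B + (if a + b + h \<in> A then a + b + h else 0)))"

lemma lattice_pairs_subset:
  assumes "(A, B) \<in> lattice_pairs a b h"
  shows "A \<subseteq> {1..a + b + h}" "B \<subseteq> {1..a + b + h}"
  using assms by (auto simp: lattice_pairs_def)

lemma lattice_pairs_finite:
  assumes "(A, B) \<in> lattice_pairs a b h"
  shows "finite A" "finite B"
  using lattice_pairs_subset[OF assms] by (auto intro: finite_subset)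

lemma finite_lattice_pairs: "finite (lattice_pairs a b h)"
proof (rule finite_subset)
  show "lattice_pairs a b h \<subseteq> Pow {1..a + b + h} \<times> Pow {1..a + b + h}"
    using lattice_pairs_subset by fastforce
qed simp

section \<open>Appending and deleting the largest entry\<close>

lemma card_insert_Suc_Int_atMost:
  assumes "A \<subseteq> {1..N}"
  shows "card (insert (Suc N) A \<inter> {..v}) = (if v \<le> N then card (A \<inter> {..v}) else Suc (card A))"
    and "\<not> v \<le> N \<Longrightarrow> card (A \<inter> {..v}) = card A"
proof -
  have fin: "finite A" and notin: "Suc N \<notin> A"
    using assms by (auto intro: finite_subset)
  show "card (insert (Suc N) A \<inter> {..v}) = (if v \<le> N then card (A \<inter> {..v}) else Suc (card A))"
  proof (cases "v \<le> N")
    case True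
    then have "insert (Suc N) A \<inter> {..v} = A \<inter> {..v}" by auto
    with True show ?thesis by simp
  next
    case False
    then have "insert (Suc N) A \<inter> {..v} = insert (Suc N) A" using assms by auto
    with False fin notin show ?thesis by simp
  qed
  assume "\<not> v \<le> N"
  then have "A \<inter> {..v} = A" using assms by auto
  then show "card (A \<inter> {..v}) = card A" by simp
qed

text \<open>Inserting \<open>Suc N\<close> changes only the counts at thresholds beyond
  \<open>N\<close>, and these are the full cardinalities. Since the threshold \<open>N\<close>
  already gives \<open>card B \<le> card A\<close>, dominance can break only when row 2 alone grows,
  and then exactly when the cardinalities were equal.\<close>

lemma dominance_insert_iff:
  assumes "A \<subseteq> {1..N}" "B \<subseteq> {1..N}"
  shows "(\<forall>v. card (B \<inter> {..v}) \<le> card (insert (Suc N) A \<inter> {..v})) \<longleftrightarrow>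
         (\<forall>v. card (B \<inter> {..v}) \<le> card (A \<inter> {..v}))"
    and "(\<forall>v. card (insert (Suc N) B \<inter> {..v}) \<le> card (A \<inter> {..v})) \<longleftrightarrow>
         (\<forall>v. card (B \<inter> {..v}) \<le> card (A \<inter> {..v})) \<and> card B < card A"
    and "(\<forall>v. card (insert (Suc N) B \<inter> {..v}) \<le> card (insert (Suc N) A \<inter> {..v})) \<longleftrightarrow>
         (\<forall>v. card (B \<inter> {..v}) \<le> card (A \<inter> {..v}))"
proof -
  note ins = card_insert_Suc_Int_atMost(1)[OF assms(1)] card_insert_Suc_Int_atMost(1)[OF assms(2)]
  note out = card_insert_Suc_Int_atMost(2)[OF assms(1)] card_insert_Suc_Int_atMost(2)[OF assms(2)]
  have whole: "A \<inter> {..N} = A" "B \<inter> {..N} = B" using assms by auto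
  have reduce: "(\<forall>v. card (B \<inter> {..v}) \<le> card (A \<inter> {..v})) \<longleftrightarrow>
      (\<forall>v\<le>N. card (B \<inter> {..v}) \<le> card (A \<inter> {..v}))"
    using out whole by (metis order_refl)
  have le: "card B \<le> card A" if "\<forall>v\<le>N. card (B \<inter> {..v}) \<le> card (A \<inter> {..v})"
    using that whole by (metis order_refl)
  show "(\<forall>v. card (B \<inter> {..v}) \<le> card (insert (Suc N) A \<inter> {..v})) \<longleftrightarrow>
         (\<forall>v. card (B \<inter> {..v}) \<le> card (A \<inter> {..v}))"
    unfolding reduce ins using out le by (auto split: if_splits simp: le_SucI)
  show "(\<forall>v. card (insert (Suc N) B \<inter> {..v}) \<le> card (A \<inter> {..v})) \<longleftrightarrow>
         (\<forall>v. card (B \<inter> {..v}) \<le> card (A \<inter> {..v})) \<and> card B < card A"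
    unfolding reduce ins using out le
    by (auto split: if_splits simp: Suc_le_eq) (metis Suc_le_eq not_less_eq_eq order_refl)
  show "(\<forall>v. card (insert (Suc N) B \<inter> {..v}) \<le> card (insert (Suc N) A \<inter> {..v})) \<longleftrightarrow>
         (\<forall>v. card (B \<inter> {..v}) \<le> card (A \<inter> {..v}))"
    unfolding reduce ins using out le by (auto split: if_splits)
qed

text \<open>The only possible new descent is \<open>N\<close>, and it needs \<open>Suc N\<close> in
  row 2. The new entry \<open>Suc N\<close> is itself no descent, because nothing larger lies in row
  2.\<close>

lemma pair_maj_insert:
  assumes "A \<subseteq> {1..N}" "B \<subseteq> {1..N}"
  shows "pair_maj (insert (Suc N) A) B = pair_maj A B"
    and "pair_maj A (insert (Suc N) B) = pair_maj A B + (if N \<in> A then N else 0)"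
    and "pair_maj (insert (Suc N) A) (insert (Suc N) B) = pair_maj A B + (if N \<in> A then N else 0)"
proof -
  have fin: "finite {i \<in> A. Suc i \<in> B}" using assms(1) by (auto intro: finite_subset)
  have notin: "N \<notin> {i \<in> A. Suc i \<in> B}" using assms(2) by auto
  have "{i \<in> insert (Suc N) A. Suc i \<in> B} = {i \<in> A. Suc i \<in> B}" using assms by auto
  then show "pair_maj (insert (Suc N) A) B = pair_maj A B" by (simp add: pair_maj_def)
  have *: "{i \<in> A. Suc i \<in> insert (Suc N) B} =
      (if N \<in> A then insert N {i \<in> A. Suc i \<in> B} else {i \<in> A. Suc i \<in> B})"
    using assms by auto
  show "pair_maj A (insert (Suc N) B) = pair_maj A B + (if N \<in> A then N else 0)"
    unfolding pair_maj_def * using fin notin by simp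
  have **: "{i \<in> insert (Suc N) A. Suc i \<in> insert (Suc N) B} =
      (if N \<in> A then insert N {i \<in> A. Suc i \<in> B} else {i \<in> A. Suc i \<in> B})"
    using assms by auto
  show "pair_maj (insert (Suc N) A) (insert (Suc N) B) = pair_maj A B + (if N \<in> A then N else 0)"
    unfolding pair_maj_def ** using fin notin by simp
qed

text \<open>The guard \<open>b < a\<close> is \<open>card B < card A\<close> with the common
  \<open>h\<close> cancelled.\<close>

lemma insert_lattice_pairs:
  assumes "(A, B) \<in> lattice_pairs a b h"
  shows "(insert (Suc (a + b + h)) A, B) \<in> lattice_pairs (Suc a) b h"
    and "b < a \<Longrightarrow> (A, insert (Suc (a + b + h)) B) \<in> lattice_pairs a (Suc b) h"
    and "(insert (Suc (a + b + h)) A, insert (Suc (a + b + h)) B) \<in> lattice_pairs a b (Suc h)"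
proof -
  define N where "N = a + b + h"
  have sub: "A \<subseteq> {1..N}" "B \<subseteq> {1..N}" and fin: "finite A" "finite B"
    using lattice_pairs_subset[OF assms] lattice_pairs_finite[OF assms] by (auto simp: N_def)
  then have notin: "Suc N \<notin> A" "Suc N \<notin> B" by auto
  have un: "A \<union> B = {1..N}" "card A = a + h" "card B = b + h"
     and dom: "\<forall>v. card (B \<inter> {..v}) \<le> card (A \<inter> {..v})"
    using assms by (auto simp: lattice_pairs_def N_def)
  have Un: "insert (Suc N) A \<union> B = {1..Suc N}" "A \<union> insert (Suc N) B = {1..Suc N}"
    using un by (auto simp: atLeastAtMostSuc_conv)
  have card: "card (insert (Suc N) A) = Suc a + h" "card (insert (Suc N) B) = Suc b + h"
    using notin fin un by auto
  have N: "Suc a + b + h = Suc N" "a + Suc b + h = Suc N" "a + b + Suc h = Suc N"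
    by (auto simp: N_def)
  note L = lattice_pairs_def mem_Collect_eq prod.case N N_def[symmetric]
    dominance_insert_iff[OF sub] card Un_insert_left Un_insert_right insert_absorb2
  show "(insert (Suc (a + b + h)) A, B) \<in> lattice_pairs (Suc a) b h"
    unfolding L using Un un dom by auto
  show "(A, insert (Suc (a + b + h)) B) \<in> lattice_pairs a (Suc b) h" if "b < a"
    unfolding L using Un un dom that by auto
  show "(insert (Suc (a + b + h)) A, insert (Suc (a + b + h)) B) \<in> lattice_pairs a b (Suc h)"
    unfolding L using Un un dom by auto
qed

text \<open>Deletion of the top entry: the bounds make \<open>Suc N\<close> a new element, so
  cardinalities drop by exactly one, and the dominance equivalences are read from left to
  right.\<close>

lemma insert_lattice_pairsD:
  assumes "A \<subseteq> {1..a + b + h}" "B \<subseteq> {1..a + b + h}"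
  shows "(insert (Suc (a + b + h)) A, B) \<in> lattice_pairs (Suc a) b h \<Longrightarrow> (A, B) \<in> lattice_pairs a b h"
    and "(A, insert (Suc (a + b + h)) B) \<in> lattice_pairs a (Suc b) h \<Longrightarrow> (A, B) \<in> lattice_pairs a b h"
    and "(insert (Suc (a + b + h)) A, insert (Suc (a + b + h)) B) \<in> lattice_pairs a b (Suc h)
      \<Longrightarrow> (A, B) \<in> lattice_pairs a b h"
proof -
  define N where "N = a + b + h"
  have sub: "A \<subseteq> {1..N}" "B \<subseteq> {1..N}" using assms by (auto simp: N_def)
  then have fin: "finite A" "finite B" and notin: "Suc N \<notin> A" "Suc N \<notin> B"
    by (auto intro: finite_subset)
  have card: "card (insert (Suc N) A) = Suc (card A)" "card (insert (Suc N) B) = Suc (card B)"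
    using notin fin by auto
  have un: "A \<union> B = {1..N}" if "insert (Suc N) (A \<union> B) = {1..Suc N}"
  proof -
    have "insert (Suc N) (A \<union> B) = insert (Suc N) {1..N}" using that by (simp add: atLeastAtMostSuc_conv)
    then show ?thesis using notin by (subst (asm) insert_ident) auto
  qed
  note d = dominance_insert_iff[OF sub]
  have N: "Suc a + b + h = Suc N" "a + Suc b + h = Suc N" "a + b + Suc h = Suc N"
    by (auto simp: N_def)
  note L = lattice_pairs_def mem_Collect_eq prod.case N N_def[symmetric] d card Un_insert_left
    Un_insert_right insert_absorb2
  show "(insert (Suc (a + b + h)) A, B) \<in> lattice_pairs (Suc a) b h \<Longrightarrow> (A, B) \<in> lattice_pairs a b h"
    unfolding L using un by auto
  show "(A, insert (Suc (a + b + h)) B) \<in> lattice_pairs a (Suc b) h \<Longrightarrow> (A, B) \<in> lattice_pairs a b h"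
    unfolding L using un by auto
  show "(insert (Suc (a + b + h)) A, insert (Suc (a + b + h)) B) \<in> lattice_pairs a b (Suc h)
      \<Longrightarrow> (A, B) \<in> lattice_pairs a b h"
    unfolding L using un by auto
qed

section \<open>Recurrences for the sums, by the rows that contain the largest entry\<close>

text \<open>The top entry must then lie in \<open>A\<close>. Deleting it is a bijection that
  preserves the major index.\<close>

lemma sum_lattice_pairs_top_notin_B:
  fixes q :: "'a::field"
  shows "(\<Sum>(A, B)\<in>{p \<in> lattice_pairs (Suc a) b h. Suc (a + b + h) \<notin> snd p}. q ^ pair_maj A B)
     = maj_sum q a b h"
proof -
  define N where "N = a + b + h"
  have rem: "(A - {Suc N}, B) \<in> lattice_pairs a b h \<and> insert (Suc N) (A - {Suc N}) = A"
    if "(A, B) \<in> lattice_pairs (Suc a) b h" "Suc N \<notin> B" for A B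
  proof -
    have un: "A \<union> B = {1..Suc N}" using that(1) by (simp add: lattice_pairs_def N_def)
    then have "Suc N \<in> A" using that(2) by force
    then have ins: "insert (Suc N) (A - {Suc N}) = A" by auto
    have "A - {Suc N} \<subseteq> {1..N}" "B \<subseteq> {1..N}"
      using un that(2) by (auto simp: set_eq_iff le_Suc_eq)
    with that(1) ins show ?thesis
      using insert_lattice_pairsD(1)[of "A - {Suc N}" a b h B] by (simp add: N_def)
  qed
  show ?thesis
    unfolding maj_sum_def N_def[symmetric]
  proof (rule sum.reindex_bij_witness[where i = "\<lambda>(A, B). (insert (Suc N) A, B)"
        and j = "\<lambda>(A, B). (A - {Suc N}, B)"], goal_cases)
    case (1 p)
    then show ?case using rem[of "fst p" "snd p"] by (cases p) auto
  next
    case (2 p)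
    then show ?case using rem[of "fst p" "snd p"] by (cases p) auto
  next
    case (3 p)
    then show ?case using lattice_pairs_subset[of "fst p" "snd p" a b h]
      by (cases p) (auto simp: N_def subset_iff)
  next
    case (4 p)
    then show ?case
      using lattice_pairs_subset[of "fst p" "snd p" a b h] insert_lattice_pairs(1)[of "fst p" "snd p" a b h]
      by (cases p) (auto simp: N_def subset_iff)
  next
    case (5 p)
    obtain A B where p: "p = (A, B)" by force
    have *: "(A - {Suc N}, B) \<in> lattice_pairs a b h" "insert (Suc N) (A - {Suc N}) = A"
      using rem[of A B] 5 p by auto
    show ?case
      using pair_maj_insert(1)[OF lattice_pairs_subset[OF *(1)]] *(2) p by (simp add: N_def)
  qed
qed

text \<open>Here the top entry is deleted from row 2; the possible descent just below it is the
  extra weight in \<open>ext_maj_sum\<close>. The assumption \<open>b < a\<close> lets every shorter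
  pair be extended.\<close>

lemma sum_lattice_pairs_top_notin_A:
  assumes "b < a"
  shows "(\<Sum>(A, B)\<in>{p \<in> lattice_pairs a (Suc b) h. Suc (a + b + h) \<notin> fst p}. q ^ pair_maj A B)
     = ext_maj_sum q a b h"
proof -
  define N where "N = a + b + h"
  have rem: "(A, B - {Suc N}) \<in> lattice_pairs a b h \<and> insert (Suc N) (B - {Suc N}) = B"
    if "(A, B) \<in> lattice_pairs a (Suc b) h" "Suc N \<notin> A" for A B
  proof -
    have un: "A \<union> B = {1..Suc N}" using that(1) by (simp add: lattice_pairs_def N_def)
    then have "Suc N \<in> B" using that(2) by force
    then have ins: "insert (Suc N) (B - {Suc N}) = B" by auto
    have "B - {Suc N} \<subseteq> {1..N}" "A \<subseteq> {1..N}"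
      using un that(2) by (auto simp: set_eq_iff le_Suc_eq)
    with that(1) ins show ?thesis
      using insert_lattice_pairsD(2)[of A a b h "B - {Suc N}"] by (simp add: N_def)
  qed
  show ?thesis
    unfolding ext_maj_sum_def N_def[symmetric]
  proof (rule sum.reindex_bij_witness[where i = "\<lambda>(A, B). (A, insert (Suc N) B)"
        and j = "\<lambda>(A, B). (A, B - {Suc N})"], goal_cases)
    case (1 p)
    then show ?case using rem[of "fst p" "snd p"] by (cases p) auto
  next
    case (2 p)
    then show ?case using rem[of "fst p" "snd p"] by (cases p) auto
  next
    case (3 p)
    then show ?case using lattice_pairs_subset[of "fst p" "snd p" a b h]
      by (cases p) (auto simp: N_def subset_iff)
  next
    case (4 p)
    then show ?case
      using lattice_pairs_subset[of "fst p" "snd p" a b h] assms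
        insert_lattice_pairs(2)[of "fst p" "snd p" a b h]
      by (cases p) (auto simp: N_def subset_iff)
  next
    case (5 p)
    obtain A B where p: "p = (A, B)" by force
    have *: "(A, B - {Suc N}) \<in> lattice_pairs a b h" "insert (Suc N) (B - {Suc N}) = B"
      using rem[of A B] 5 p by auto
    show ?case
      using pair_maj_insert(2)[OF lattice_pairs_subset[OF *(1)]] *(2) p by (simp add: N_def)
  qed
qed

text \<open>The weight is again that of \<open>ext_maj_sum\<close>, since only the presence of the
  new entry in row 2 matters for a descent. Both counts grow together, so every shorter pair
  extends.\<close>

lemma sum_lattice_pairs_top_in_both:
  fixes q :: "'a::field"
  shows "(\<Sum>(A, B)\<in>{p \<in> lattice_pairs a b (Suc h). Suc (a + b + h) \<in> fst p \<and> Suc (a + b + h) \<in> snd p}.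
      q ^ pair_maj A B) = ext_maj_sum q a b h"
proof -
  define N where "N = a + b + h"
  have rem: "(A - {Suc N}, B - {Suc N}) \<in> lattice_pairs a b h"
    "insert (Suc N) (A - {Suc N}) = A" "insert (Suc N) (B - {Suc N}) = B"
    if "(A, B) \<in> lattice_pairs a b (Suc h)" "Suc N \<in> A" "Suc N \<in> B" for A B
  proof -
    have un: "A \<union> B = {1..Suc N}" using that(1) by (simp add: lattice_pairs_def N_def)
    show ins: "insert (Suc N) (A - {Suc N}) = A" "insert (Suc N) (B - {Suc N}) = B"
      using that by auto
    have "B - {Suc N} \<subseteq> {1..N}" "A - {Suc N} \<subseteq> {1..N}"
      using un by (auto simp: set_eq_iff le_Suc_eq)
    with that(1) ins show "(A - {Suc N}, B - {Suc N}) \<in> lattice_pairs a b h"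
      using insert_lattice_pairsD(3)[of "A - {Suc N}" a b h "B - {Suc N}"] by (simp add: N_def)
  qed
  show ?thesis
    unfolding ext_maj_sum_def N_def[symmetric]
  proof (rule sum.reindex_bij_witness[where i = "\<lambda>(A, B). (insert (Suc N) A, insert (Suc N) B)"
        and j = "\<lambda>(A, B). (A - {Suc N}, B - {Suc N})"], goal_cases)
    case (1 p)
    then show ?case using rem[of "fst p" "snd p"] by (cases p) auto
  next
    case (2 p)
    then show ?case using rem[of "fst p" "snd p"] by (cases p) auto
  next
    case (3 p)
    then show ?case using lattice_pairs_subset[of "fst p" "snd p" a b h]
      by (cases p) (auto simp: N_def subset_iff)
  next
    case (4 p)
    then show ?case
      using insert_lattice_pairs(3)[of "fst p" "snd p" a b h]
      by (cases p) (auto simp: N_def)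
  next
    case (5 p)
    obtain A B where p: "p = (A, B)" by force
    have *: "(A - {Suc N}, B - {Suc N}) \<in> lattice_pairs a b h"
        "insert (Suc N) (A - {Suc N}) = A" "insert (Suc N) (B - {Suc N}) = B"
      using rem[of A B] 5 p by auto
    have "(N \<in> A) = (N \<in> A - {Suc N})" by auto
    then show ?case
      using pair_maj_insert(3)[OF lattice_pairs_subset[OF *(1)]] *(2,3) p by (simp add: N_def)
  qed
qed

text \<open>Boundary cases of the recurrence: if no entry lies in row 1 only, row 2 is the whole
  interval, and symmetrically; with \<open>h = 0\<close> the cardinalities add up to that of the
  union, so the rows are disjoint.\<close>

lemma lattice_pairs_0:
  assumes "0 < a + b + h" "(A, B) \<in> lattice_pairs a b h"
  shows "a = 0 \<Longrightarrow> a + b + h \<in> B"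
    and "b = 0 \<Longrightarrow> a + b + h \<in> A"
    and "h = 0 \<Longrightarrow> A \<inter> B = {}"
proof -
  have AB: "A \<union> B = {1..a + b + h}" "card A = a + h" "card B = b + h"
    using assms(2) by (auto simp: lattice_pairs_def)
  note sub = lattice_pairs_subset[OF assms(2)]
  show "a + b + h \<in> B" if "a = 0"
  proof -
    have "B = {1..a + b + h}" using card_subset_eq[OF _ sub(2)] AB that by simp
    then show ?thesis using assms(1) by auto
  qed
  show "a + b + h \<in> A" if "b = 0"
  proof -
    have "A = {1..a + b + h}" using card_subset_eq[OF _ sub(1)] AB that by simp
    then show ?thesis using assms(1) by auto
  qed
  show "A \<inter> B = {}" if "h = 0"
    using card_Un_Int[OF lattice_pairs_finite[OF assms(2)]] AB that lattice_pairs_finite[OF assms(2)]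
    by simp
qed

text \<open>Dominance at the threshold \<open>a + b + h\<close> compares the full cardinalities
  \<open>b + h\<close> and \<open>a + h\<close>.\<close>

lemma lattice_pairs_eq_empty:
  assumes "a < b"
  shows "lattice_pairs a b h = {}"
proof -
  have False if p: "(A, B) \<in> lattice_pairs a b h" for A B
  proof -
    have "A \<inter> {..a + b + h} = A" "B \<inter> {..a + b + h} = B"
      using lattice_pairs_subset[OF p] by auto
    moreover have "card (B \<inter> {..a + b + h}) \<le> card (A \<inter> {..a + b + h})"
      using p unfolding lattice_pairs_def by blast
    moreover have "card A = a + h" "card B = b + h" using p by (auto simp: lattice_pairs_def)
    ultimately show False using assms by simp
  qed
  then show ?thesis by auto
qed

lemma sum_lattice_pairs_top_notin_A':
  assumes "b \<le> a" "0 < a + b + h"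
  shows "(\<Sum>(A, B)\<in>{p \<in> lattice_pairs a b h. a + b + h \<notin> fst p}. q ^ pair_maj A B)
     = (if b = 0 then 0 else ext_maj_sum q a (b - 1) h)"
proof (cases b)
  case 0
  have "{p \<in> lattice_pairs a b h. a + b + h \<notin> fst p} = {}"
    using lattice_pairs_0(2)[OF assms(2)] 0 by auto
  with 0 show ?thesis by (metis sum.empty)
next
  case (Suc b')
  then show ?thesis using sum_lattice_pairs_top_notin_A[where a = a and b = b' and h = h and q = q] assms(1) by simp
qed

lemma maj_sum_rec:
  assumes "b \<le> a" "0 < a + b + h"
  shows "maj_sum q a b h =
    (if a = b then 0 else maj_sum q (a - 1) b h) +
    (if b = 0 then 0 else ext_maj_sum q a (b - 1) h) +
    (if h = 0 then 0 else ext_maj_sum q a b (h - 1))"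
proof -
  define N where "N = a + b + h"
  let ?g = "\<lambda>(A, B). q ^ pair_maj A B"
  let ?S = "lattice_pairs a b h"
  \<comment> \<open>Besides exhausting all pairs, this makes the two classes where \<open>N\<close>
    is missing from one row disjoint.\<close>
  have cover: "N \<in> fst p \<or> N \<in> snd p" if "p \<in> ?S" for p
    using that assms(2) by (force simp: lattice_pairs_def N_def)
  have S: "?S = ({p \<in> ?S. N \<notin> snd p} \<union> {p \<in> ?S. N \<notin> fst p}) \<union>
      {p \<in> ?S. N \<in> fst p \<and> N \<in> snd p}"
    using cover by auto
  have "maj_sum q a b h = sum ?g {p \<in> ?S. N \<notin> snd p} + sum ?g {p \<in> ?S. N \<notin> fst p} +
      sum ?g {p \<in> ?S. N \<in> fst p \<and> N \<in> snd p}"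
    unfolding maj_sum_def
    using finite_lattice_pairs[of a b h]
    by (subst S, subst sum.union_disjoint, auto dest: cover,
        subst sum.union_disjoint, auto dest: cover)
  moreover have "sum ?g {p \<in> ?S. N \<notin> snd p} = (if a = b then 0 else maj_sum q (a - 1) b h)"
  proof (cases a)
    case 0
    have "{p \<in> ?S. N \<notin> snd p} = {}"
      using lattice_pairs_0(1)[OF assms(2)] 0 by (auto simp: N_def)
    with 0 assms(1) show ?thesis by (metis le_zero_eq sum.empty)
  next
    case (Suc a')
    have "sum ?g {p \<in> ?S. N \<notin> snd p} = maj_sum q a' b h"
      using sum_lattice_pairs_top_notin_B[where a = a' and b = b and h = h and q = q] Suc by (simp add: N_def)
    \<comment> \<open>On the diagonal the shorter pairs would violate the ballot condition, which
      justifies the value 0 in the recurrence.\<close>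
    moreover have "maj_sum q a' b h = 0" if "a = b"
      using lattice_pairs_eq_empty[of a' b h] that Suc by (simp add: maj_sum_def)
    ultimately show ?thesis using Suc by simp
  qed
  moreover have "sum ?g {p \<in> ?S. N \<notin> fst p} = (if b = 0 then 0 else ext_maj_sum q a (b - 1) h)"
    unfolding N_def by (rule sum_lattice_pairs_top_notin_A'[OF assms])
  moreover have "sum ?g {p \<in> ?S. N \<in> fst p \<and> N \<in> snd p} =
      (if h = 0 then 0 else ext_maj_sum q a b (h - 1))"
  proof (cases h)
    case 0
    have "{p \<in> ?S. N \<in> fst p \<and> N \<in> snd p} = {}"
      using lattice_pairs_0(3)[OF assms(2)] 0 by (auto simp: N_def)
    with 0 show ?thesis by (metis sum.empty)
  next
    case (Suc h')
    then show ?thesis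
      using sum_lattice_pairs_top_in_both[where a = a and b = b and h = h' and q = q] by (simp add: N_def)
  qed
  ultimately show ?thesis by simp
qed

text \<open>The extra weight is \<open>q ^ N\<close> if \<open>N \<in> A\<close> and 1 otherwise,
  that is, \<open>q ^ N\<close> plus \<open>1 - q ^ N\<close> on the pairs with
  \<open>N \<notin> A\<close>. The latter pairs are summed by deleting \<open>N\<close> from row 2,
  which closes the system of recurrences.\<close>

lemma ext_maj_sum_rec:
  assumes "b \<le> a"
  shows "ext_maj_sum q a b h = q ^ (a + b + h) * maj_sum q a b h +
    (1 - q ^ (a + b + h)) * (if b = 0 then 0 else ext_maj_sum q a (b - 1) h)"
proof (cases "a + b + h = 0")
  case True
  then show ?thesis by (simp add: ext_maj_sum_def maj_sum_def cong: if_cong)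
next
  case False
  define N where "N = a + b + h"
  let ?g = "\<lambda>(A, B). q ^ pair_maj A B"
  let ?S = "lattice_pairs a b h"
  have "ext_maj_sum q a b h =
      (\<Sum>p\<in>?S. q ^ N * ?g p + (1 - q ^ N) * (if N \<notin> fst p then ?g p else 0))"
    unfolding ext_maj_sum_def N_def[symmetric]
    by (rule sum.cong) (auto simp: power_add algebra_simps)
  also have "\<dots> = q ^ N * maj_sum q a b h + (1 - q ^ N) * sum ?g {p \<in> ?S. N \<notin> fst p}"
    using finite_lattice_pairs[of a b h]
    by (simp add: sum.distrib sum_distrib_left[symmetric] maj_sum_def sum.inter_filter)
  finally show ?thesis
    using sum_lattice_pairs_top_notin_A'[where q = q and h = h, OF assms] False by (simp add: N_def)
qed

section \<open>q-numbers and the closed forms\<close>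

lemma qfact_Suc: "qfact q (Suc m) = qfact q m * qnum q (Suc m)"
  by (simp add: qfact_def)

lemma qnum_add: "qnum q (m + n) = qnum q m + q ^ m * qnum q n"
  by (induction n) (simp_all add: qnum_def power_add algebra_simps)

lemma one_minus_power_eq_qnum: "1 - q ^ m = (1 - q) * qnum q m"
  by (simp add: qnum_def one_diff_power_eq)

text \<open>The q-trinomial coefficient, twisted by \<open>q ^ (h choose 2)\<close>; this is
  \<open>M\<close> of the introduction.\<close>

definition qtrinom :: "'a::field \<Rightarrow> nat \<Rightarrow> nat \<Rightarrow> nat \<Rightarrow> 'a" where
  "qtrinom q a b h =
     q ^ (h choose 2) * qfact q (a + b + h) / (qfact q a * qfact q b * qfact q h)"

lemma qtrinom_commute: "qtrinom q a b h = qtrinom q b a h"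
  by (simp add: qtrinom_def ac_simps)

text \<open>The reflection difference. The explicit 0 at \<open>b = 0\<close> keeps truncated
  subtraction from producing a spurious term.\<close>

definition ballot_sum :: "'a::field \<Rightarrow> nat \<Rightarrow> nat \<Rightarrow> nat \<Rightarrow> 'a" where
  "ballot_sum q a b h = qtrinom q a b h - (if b = 0 then 0 else qtrinom q (Suc a) (b - 1) h)"

text \<open>The companion of \<open>qtrinom q a b h\<close> in the recurrence is
  \<open>q ^ (a + h)\<close> times it, the exponent being the size of row 1. Reflection raises
  \<open>a\<close>, and with it the exponent, by one.\<close>

definition ext_ballot_sum :: "'a::field \<Rightarrow> nat \<Rightarrow> nat \<Rightarrow> nat \<Rightarrow> 'a" where
  "ext_ballot_sum q a b h = q ^ (a + h) * qtrinom q a b h -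
     (if b = 0 then 0 else q ^ (Suc a + h) * qtrinom q (Suc a) (b - 1) h)"

section \<open>Recurrences for the closed forms, over a field where no positive q-number
  vanishes\<close>

context
  fixes q :: "'a::field"
  assumes qnum_nonzero: "\<And>m. qnum q (Suc m) \<noteq> 0"
begin

lemma qfact_nonzero: "qfact q m \<noteq> 0"
  by (induction m) (simp_all add: qfact_Suc qnum_nonzero, simp add: qfact_def)

text \<open>Absorption identities, which replace division by q-factorials below. The factor
  \<open>q ^ h\<close> is the growth of the twist from \<open>h choose 2\<close> to
  \<open>Suc h choose 2\<close>.\<close>

lemma qnum_mult_qtrinom_Suc:
  shows "qnum q (Suc a) * qtrinom q (Suc a) b h = qnum q (Suc (a + b + h)) * qtrinom q a b h"
    and "qnum q (Suc b) * qtrinom q a (Suc b) h = qnum q (Suc (a + b + h)) * qtrinom q a b h"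
    and "qnum q (Suc h) * qtrinom q a b (Suc h) = q ^ h * (qnum q (Suc (a + b + h)) * qtrinom q a b h)"
proof -
  have "Suc h choose 2 = h + (h choose 2)" by (simp add: numeral_2_eq_2)
  then show "qnum q (Suc h) * qtrinom q a b (Suc h) = q ^ h * (qnum q (Suc (a + b + h)) * qtrinom q a b h)"
    using qnum_nonzero[of h] qfact_nonzero
    by (simp add: qtrinom_def qfact_Suc field_simps power_add)
  show "qnum q (Suc a) * qtrinom q (Suc a) b h = qnum q (Suc (a + b + h)) * qtrinom q a b h"
    using qnum_nonzero[of a] qfact_nonzero
    by (simp add: qtrinom_def qfact_Suc field_simps)
  show "qnum q (Suc b) * qtrinom q a (Suc b) h = qnum q (Suc (a + b + h)) * qtrinom q a b h"
    using qnum_nonzero[of b] qfact_nonzero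
    by (simp add: qtrinom_def qfact_Suc field_simps)
qed

text \<open>After multiplication by the q-number of the total, absorption turns each term on the
  right into a multiple of \<open>qtrinom q a b h\<close>; what remains is the splitting of that
  q-number into three blocks.\<close>

lemma qtrinom_rec:
  assumes "0 < a + b + h"
  shows "qtrinom q a b h =
    (if a = 0 then 0 else qtrinom q (a - 1) b h) +
    (if b = 0 then 0 else q ^ (a + h) * qtrinom q a (b - 1) h) +
    (if h = 0 then 0 else q ^ (a + (h - 1)) * qtrinom q a b (h - 1))"
proof -
  obtain N where N: "a + b + h = Suc N" using assms by (cases "a + b + h") auto
  have 1: "qnum q (Suc N) * (if a = 0 then 0 else qtrinom q (a - 1) b h) = qnum q a * qtrinom q a b h"
    using qnum_mult_qtrinom_Suc(1)[of "a - 1" b h] N by (cases a) (auto simp: qnum_def)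
  have 2: "qnum q (Suc N) * (if b = 0 then 0 else q ^ (a + h) * qtrinom q a (b - 1) h) =
      q ^ (a + h) * (qnum q b * qtrinom q a b h)"
    using qnum_mult_qtrinom_Suc(2)[of "b - 1" a h] N by (cases b) (auto simp: qnum_def)
  have 3: "qnum q (Suc N) * (if h = 0 then 0 else q ^ (a + (h - 1)) * qtrinom q a b (h - 1)) =
      q ^ a * (qnum q h * qtrinom q a b h)"
    using qnum_mult_qtrinom_Suc(3)[of "h - 1" a b] N
    by (cases h) (auto simp: qnum_def power_add)
  \<comment> \<open>The order of the blocks matters: \<open>a\<close>, then \<open>h\<close>, then
    \<open>b\<close> yields the powers \<open>q ^ a\<close> and \<open>q ^ (a + h)\<close> of facts
    3 and 2.\<close>
  have "Suc N = a + (h + b)" using N by simp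
  then have "qnum q (Suc N) = qnum q a + q ^ a * qnum q h + q ^ (a + h) * qnum q b"
    by (simp only: qnum_add) (simp add: power_add algebra_simps)
  then have "qnum q (Suc N) * qtrinom q a b h = qnum q (Suc N) *
    ((if a = 0 then 0 else qtrinom q (a - 1) b h) +
    (if b = 0 then 0 else q ^ (a + h) * qtrinom q a (b - 1) h) +
    (if h = 0 then 0 else q ^ (a + (h - 1)) * qtrinom q a b (h - 1)))"
    unfolding distrib_left 1 2 3 by (simp add: algebra_simps)
  then show ?thesis using qnum_nonzero[of N] by (metis mult_left_cancel)
qed

text \<open>Absorption in \<open>b\<close>, multiplied by \<open>1 - q\<close>, trades
  \<open>1 - q ^ (a + b + h)\<close> at \<open>b - 1\<close> for \<open>1 - q ^ b\<close> at
  \<open>b\<close>; the powers of \<open>q\<close> then telescope.\<close>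

lemma qtrinom_ext_rec:
  "q ^ (a + h) * qtrinom q a b h = q ^ (a + b + h) * qtrinom q a b h +
     (1 - q ^ (a + b + h)) * (if b = 0 then 0 else q ^ (a + h) * qtrinom q a (b - 1) h)"
proof (cases b)
  case (Suc b')
  have "(1 - q ^ (a + b + h)) * qtrinom q a b' h = (1 - q ^ b) * qtrinom q a b h"
    using qnum_mult_qtrinom_Suc(2)[of b' a h] Suc
    by (simp add: one_minus_power_eq_qnum[of q] del: power_Suc)
  then have "q ^ (a + h) * ((1 - q ^ (a + b + h)) * qtrinom q a b' h) =
      q ^ (a + h) * ((1 - q ^ b) * qtrinom q a b h)" by simp
  then show ?thesis using Suc by (simp add: algebra_simps power_add)
qed simp

text \<open>Difference of \<open>qtrinom_rec\<close> at \<open>(a, b, h)\<close> and at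
  \<open>(a + 1, b - 1, h)\<close>. For \<open>a = b\<close> the two first terms are mirror images
  and cancel by \<open>qtrinom_commute\<close>.\<close>

lemma ballot_sum_rec:
  assumes "b \<le> a" "0 < a + b + h"
  shows "ballot_sum q a b h =
    (if a = b then 0 else ballot_sum q (a - 1) b h) +
    (if b = 0 then 0 else ext_ballot_sum q a (b - 1) h) +
    (if h = 0 then 0 else ext_ballot_sum q a b (h - 1))"
proof (cases b)
  case 0
  then show ?thesis
    using qtrinom_rec[of a 0 h] assms by (auto simp: ballot_sum_def ext_ballot_sum_def)
next
  case (Suc b')
  then obtain a' where a: "a = Suc a'" using assms by (cases a) auto
  show ?thesis
    using qtrinom_rec[OF assms(2)] qtrinom_rec[of "Suc a" b' h] Suc a qtrinom_commute[of q a' a h]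
    by (auto simp: ballot_sum_def ext_ballot_sum_def)
qed

text \<open>The two instances of \<open>qtrinom_ext_rec\<close> share the same total, hence the same
  coefficients, and can be subtracted.\<close>

lemma ext_ballot_sum_rec:
  "ext_ballot_sum q a b h = q ^ (a + b + h) * ballot_sum q a b h +
    (1 - q ^ (a + b + h)) * (if b = 0 then 0 else ext_ballot_sum q a (b - 1) h)"
proof (cases b)
  case 0
  then show ?thesis by (auto simp: ballot_sum_def ext_ballot_sum_def)
next
  case (Suc b')
  show ?thesis
    using qtrinom_ext_rec[of a h b] qtrinom_ext_rec[of "Suc a" h b'] Suc
    by (auto simp: ballot_sum_def ext_ballot_sum_def algebra_simps)
qed

text \<open>Both equalities are proved in one induction on the total. At each triple
  \<open>maj_sum\<close> comes first, since the recurrence for \<open>ext_maj_sum\<close> refers to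
  it at the same triple.\<close>

lemma maj_sum_eq_ballot_sum:
  assumes "b \<le> a"
  shows "maj_sum q a b h = ballot_sum q a b h \<and> ext_maj_sum q a b h = ext_ballot_sum q a b h"
  using assms
proof (induction "a + b + h" arbitrary: a b h rule: less_induct)
  case less
  have "maj_sum q a b h = ballot_sum q a b h"
  proof (cases "a + b + h = 0")
    case True
    have "lattice_pairs 0 0 0 = {({}, {})}"
      by (auto simp: lattice_pairs_def)
    with True show ?thesis
      by (simp add: maj_sum_def pair_maj_def ballot_sum_def qtrinom_def qfact_def numeral_2_eq_2)
  next
    case False
    then have pos: "0 < a + b + h" by simp
    have 1: "maj_sum q (a - 1) b h = ballot_sum q (a - 1) b h" if "a \<noteq> b"
      using less(1)[of "a - 1" b h] less(2) that by simp
    have 2: "ext_maj_sum q a (b - 1) h = ext_ballot_sum q a (b - 1) h" if "b \<noteq> 0"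
      using less(1)[of a "b - 1" h] less(2) that by simp
    have 3: "ext_maj_sum q a b (h - 1) = ext_ballot_sum q a b (h - 1)" if "h \<noteq> 0"
      using less(1)[of a b "h - 1"] less(2) that by simp
    show ?thesis
      unfolding maj_sum_rec[OF less(2) pos] ballot_sum_rec[OF less(2) pos]
      using 1 2 3 by (simp cong: if_cong)
  qed
  moreover have "ext_maj_sum q a (b - 1) h = ext_ballot_sum q a (b - 1) h" if "b \<noteq> 0"
    using less(1)[of a "b - 1" h] less(2) that by simp
  ultimately show ?case
    using ext_maj_sum_rec[OF less(2), of q h] ext_ballot_sum_rec[of a b h] by simp
qed

text \<open>For \<open>m > 0\<close>, absorbing from \<open>(m, m - 1, k)\<close> in two ways shows
  that the reflected term is \<open>[m] / [m + 1]\<close> times the main one, and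
  \<open>[m + 1] - [m] = q ^ m\<close>.\<close>

lemma ballot_sum_diagonal:
  "ballot_sum q m m k = q ^ (m + (k choose 2)) / qnum q (m + 1)
     * qbinom q (2 * m + k) k * qbinom q (2 * m) m"
proof -
  have "qnum q (Suc m) * ballot_sum q m m k = q ^ m * qtrinom q m m k"
  proof (cases m)
    case 0
    then show ?thesis by (simp add: ballot_sum_def qnum_def)
  next
    case (Suc m')
    have "qnum q (Suc m) * qtrinom q (Suc m) m' k = qnum q m * qtrinom q m m k"
      using qnum_mult_qtrinom_Suc(1)[of m m' k] qnum_mult_qtrinom_Suc(2)[of m' m k] Suc by simp
    moreover have "qnum q (Suc m) = qnum q m + q ^ m" by (simp add: qnum_def)
    ultimately show ?thesis using Suc by (simp add: ballot_sum_def algebra_simps)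
  qed
  then have "ballot_sum q m m k = q ^ m * qtrinom q m m k / qnum q (Suc m)"
    using qnum_nonzero[of m] by (simp add: field_simps)
  moreover have "qtrinom q m m k = q ^ (k choose 2) * qbinom q (2 * m + k) k * qbinom q (2 * m) m"
    using qfact_nonzero by (simp add: qtrinom_def qbinom_def mult_2 field_simps flip: mult_2)
  ultimately show ?thesis by (simp add: power_add)
qed

end

text \<open>These q-numbers come from integer polynomials with constant term 1, seen by evaluating
  at 0.\<close>

lemma qnum_qvar_nonzero: "qnum qvar (Suc m) \<noteq> 0"
proof -
  have power: "to_fract (p ^ i) = to_fract p ^ i" for p :: "int poly" and i
    by (induction i) simp_all
  have "qnum qvar j = to_fract (\<Sum>i<j. [:0, 1:] ^ i)" for j
    by (induction j) (simp_all add: qnum_def qvar_def power)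
  moreover have "poly (\<Sum>i<Suc m. [:0, 1::int:] ^ i) 0 = 1"
    by (simp add: poly_sum lessThan_Suc_eq_insert_0 sum.reindex)
  ultimately show ?thesis by (metis poly_0 to_fract_eq_0_iff zero_neq_one)
qed

section \<open>Arrays as pairs of row sets\<close>

lemma card_strict_mono_image_Int_atMost:
  fixes f :: "nat \<Rightarrow> nat"
  assumes "strict_mono_on {1..n} f"
  shows "card (f ` {1..n} \<inter> {..v}) = card {j \<in> {1..n}. f j \<le> v}"
proof -
  have "f ` {1..n} \<inter> {..v} = f ` {j \<in> {1..n}. f j \<le> v}" by auto
  moreover have "inj_on f {j \<in> {1..n}. f j \<le> v}"
    using strict_mono_on_imp_inj_on[OF assms] by (rule inj_on_subset) auto
  ultimately show ?thesis by (simp add: card_image)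
qed

lemma strict_mono_rank:
  fixes f :: "nat \<Rightarrow> nat"
  assumes "strict_mono_on {1..n} f" "j \<in> {1..n}"
  shows "{i \<in> {1..n}. f i \<le> f j} = {1..j}"
  using strict_mono_on_less_eq[OF assms(1)] assms(2) by auto

text \<open>Counting values up to \<open>v\<close> is counting columns. If column \<open>j\<close>
  fails, the threshold \<open>g j\<close> sees at least \<open>j\<close> values of \<open>g\<close>
  but fewer than \<open>j\<close> of \<open>f\<close>.\<close>

lemma dominance_iff_columns_le:
  fixes f g :: "nat \<Rightarrow> nat"
  assumes f: "strict_mono_on {1..n} f" and g: "strict_mono_on {1..n} g"
  shows "(\<forall>v. card (g ` {1..n} \<inter> {..v}) \<le> card (f ` {1..n} \<inter> {..v})) \<longleftrightarrow>
    (\<forall>j\<in>{1..n}. f j \<le> g j)"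
  unfolding card_strict_mono_image_Int_atMost[OF f] card_strict_mono_image_Int_atMost[OF g]
proof
  assume le: "\<forall>j\<in>{1..n}. f j \<le> g j"
  show "\<forall>v. card {j \<in> {1..n}. g j \<le> v} \<le> card {j \<in> {1..n}. f j \<le> v}"
    using le by (auto intro!: card_mono intro: order_trans)
next
  assume dom: "\<forall>v. card {j \<in> {1..n}. g j \<le> v} \<le> card {j \<in> {1..n}. f j \<le> v}"
  show "\<forall>j\<in>{1..n}. f j \<le> g j"
  proof (rule ccontr)
    assume "\<not> ?thesis"
    then obtain j where j: "j \<in> {1..n}" "g j < f j" by auto
    have "{i \<in> {1..n}. f i \<le> g j} \<subseteq> {1..<j}"
    proof
      fix i assume i: "i \<in> {i \<in> {1..n}. f i \<le> g j}"
      then have "f i < f j" using j by simp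
      then show "i \<in> {1..<j}" using strict_mono_on_less[OF f, of i j] i j by auto
    qed
    then have "card {i \<in> {1..n}. f i \<le> g j} \<le> card {1..<j}" by (intro card_mono) auto
    moreover have "j \<le> card {i \<in> {1..n}. f i \<le> g j}"
      using dom[rule_format, of "g j"] strict_mono_rank[OF g j(1)] by simp
    ultimately show False using j by auto
  qed
qed

text \<open>Equal images dominate each other, so the column inequalities hold both ways.\<close>

lemma strict_mono_eq_of_image_eq:
  fixes f g :: "nat \<Rightarrow> nat"
  assumes "strict_mono_on {1..n} f" "strict_mono_on {1..n} g" "f ` {1..n} = g ` {1..n}"
    and "j \<in> {1..n}"
  shows "f j = g j"
proof -
  have "\<forall>j\<in>{1..n}. f j \<le> g j" "\<forall>j\<in>{1..n}. g j \<le> f j"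
    using dominance_iff_columns_le[of n f g] dominance_iff_columns_le[of n g f] assms(1-3) by auto
  then show ?thesis using assms(4) by (simp add: antisym)
qed

lemma ex_strict_mono_enumeration:
  fixes A :: "nat set"
  assumes "finite A" "card A = n"
  shows "\<exists>f. strict_mono_on {1..n} f \<and> f ` {1..n} = A"
proof -
  obtain h where h: "bij_betw h {..<card A} A" "strict_mono_on {..<card A} h"
    using ex_bij_betw_strict_mono_card[OF assms(1)] .
  \<comment> \<open>The enumeration \<open>h\<close> starts at 0, whereas columns start at
    1.\<close>
  have "strict_mono_on {1..n} (\<lambda>j. h (j - 1))"
    using h(2) assms(2) by (auto intro!: strict_mono_onI strict_mono_onD[OF h(2)])
  moreover have "(\<lambda>j. j - 1) ` {1..n} = {..<n}"
    by (auto simp: image_iff intro!: bexI[of _ "Suc _"])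
  then have "(\<lambda>j. h (j - 1)) ` {1..n} = A"
    using h(1) assms(2) unfolding bij_betw_def by (metis image_image)
  ultimately show ?thesis by blast
qed

definition row_sets :: "nat \<Rightarrow> (nat \<times> nat \<Rightarrow> nat) \<Rightarrow> nat set \<times> nat set" where
  "row_sets n T = ((\<lambda>j. T (1, j)) ` {1..n}, (\<lambda>j. T (2, j)) ` {1..n})"

lemma cells_image: "T ` cells n = (\<lambda>j. T (1, j)) ` {1..n} \<union> (\<lambda>j. T (2, j)) ` {1..n}"
proof -
  have "{1..2::nat} = {1, 2}" by auto
  then show ?thesis by (auto simp: cells_def)
qed

lemma RInc_iff:
  "T \<in> RInc k n \<longleftrightarrow> T \<in> extensional (cells n) \<and> strict_mono_on {1..n} (\<lambda>j. T (1, j)) \<and>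
    strict_mono_on {1..n} (\<lambda>j. T (2, j)) \<and> (\<forall>j\<in>{1..n}. T (1, j) \<le> T (2, j)) \<and>
    (\<lambda>j. T (1, j)) ` {1..n} \<union> (\<lambda>j. T (2, j)) ` {1..n} = {1..2 * n - k}"
proof -
  have "{1..2::nat} = {1, 2}" by auto
  moreover have "T \<in> cells n \<rightarrow> {1..}" if "T ` cells n = {1..2 * n - k}"
  proof
    fix x assume "x \<in> cells n"
    then have "T x \<in> {1..2 * n - k}" using that by blast
    then show "T x \<in> {1..}" by simp
  qed
  ultimately show ?thesis
    unfolding RInc_def PiE_def cells_image[symmetric] by auto
qed

text \<open>Two rows of size \<open>n\<close> covering \<open>2 * n - k\<close> values share
  \<open>k\<close> of them, leaving \<open>n - k\<close> in each row alone. A strictly increasing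
  row is determined by its set, and each set of size \<open>n\<close> can be enumerated as a
  row.\<close>

lemma bij_betw_row_sets:
  assumes "k \<le> n"
  shows "bij_betw (row_sets n) (RInc k n) (lattice_pairs (n - k) (n - k) k)"
proof (rule bij_betw_imageI)
  have N: "n - k + (n - k) + k = 2 * n - k" "n - k + k = n" using assms by auto
  show "inj_on (row_sets n) (RInc k n)"
  proof (rule inj_onI)
    fix T T' assume T: "T \<in> RInc k n" "T' \<in> RInc k n" "row_sets n T = row_sets n T'"
    show "T = T'"
    proof (rule extensionalityI)
      show "T \<in> extensional (cells n)" "T' \<in> extensional (cells n)" using T by (auto simp: RInc_iff)
      fix x assume "x \<in> cells n"
      then obtain i j where x: "x = (i, j)" "i = 1 \<or> i = 2" "j \<in> {1..n}"
        by (auto simp: cells_def) (metis One_nat_def Suc_1 le_Suc_eq le_antisym)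
      have "T (1, j) = T' (1, j)" "T (2, j) = T' (2, j)"
        using T x(3) strict_mono_eq_of_image_eq[of n "\<lambda>j. T (1, j)" "\<lambda>j. T' (1, j)" j]
          strict_mono_eq_of_image_eq[of n "\<lambda>j. T (2, j)" "\<lambda>j. T' (2, j)" j]
        by (auto simp: RInc_iff row_sets_def)
      then show "T x = T' x" using x by auto
    qed
  qed
  show "row_sets n ` RInc k n = lattice_pairs (n - k) (n - k) k"
  proof (intro equalityI subsetI)
    fix p assume "p \<in> row_sets n ` RInc k n"
    then obtain T where T: "T \<in> RInc k n" "p = row_sets n T" by auto
    then have mono: "strict_mono_on {1..n} (\<lambda>j. T (1, j))" "strict_mono_on {1..n} (\<lambda>j. T (2, j))"
      by (auto simp: RInc_iff)
    show "p \<in> lattice_pairs (n - k) (n - k) k"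
      unfolding T(2) row_sets_def lattice_pairs_def mem_Collect_eq prod.case N
        dominance_iff_columns_le[OF mono]
      using T(1) mono[THEN strict_mono_on_imp_inj_on] by (simp add: RInc_iff card_image)
  next
    fix p assume "p \<in> lattice_pairs (n - k) (n - k) k"
    then obtain A B where p: "p = (A, B)" "(A, B) \<in> lattice_pairs (n - k) (n - k) k" by (cases p) auto
    have AB: "A \<union> B = {1..2 * n - k}" "card A = n" "card B = n"
      and dom: "\<forall>v. card (B \<inter> {..v}) \<le> card (A \<inter> {..v})"
      using p(2) unfolding lattice_pairs_def mem_Collect_eq prod.case N by auto
    obtain f where f: "strict_mono_on {1..n} f" "f ` {1..n} = A"
      using ex_strict_mono_enumeration[OF lattice_pairs_finite(1)[OF p(2)] AB(2)] by auto
    obtain g where g: "strict_mono_on {1..n} g" "g ` {1..n} = B"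
      using ex_strict_mono_enumeration[OF lattice_pairs_finite(2)[OF p(2)] AB(3)] by auto
    define T where "T = restrict (\<lambda>(i, j). if i = 1 then f j else g j) (cells n)"
    have Tf: "T (1, j) = f j" and Tg: "T (2, j) = g j" if "j \<in> {1..n}" for j
      using that by (auto simp: T_def cells_def)
    have im: "(\<lambda>j. T (1, j)) ` {1..n} = A" "(\<lambda>j. T (2, j)) ` {1..n} = B"
      using Tf Tg f(2) g(2) by (auto simp: image_iff)
    have "strict_mono_on {1..n} (\<lambda>j. T (1, j))" "strict_mono_on {1..n} (\<lambda>j. T (2, j))"
      using f(1) g(1) by (auto simp: strict_mono_on_def Tf Tg simp del: One_nat_def)
    moreover have "\<forall>j\<in>{1..n}. T (1, j) \<le> T (2, j)"
      using dominance_iff_columns_le[OF f(1) g(1)] dom f(2) g(2) Tf Tg by auto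
    moreover have "T \<in> extensional (cells n)" by (simp add: T_def)
    ultimately have "T \<in> RInc k n" using im AB(1) by (simp add: RInc_iff)
    then show "p \<in> row_sets n ` RInc k n" using im p(1) by (auto simp: row_sets_def intro!: image_eqI)
  qed
qed

lemma maj_eq_pair_maj: "maj n T = (case row_sets n T of (A, B) \<Rightarrow> pair_maj A B)"
proof -
  have "descents n T = {i \<in> (\<lambda>j. T (1, j)) ` {1..n}. Suc i \<in> (\<lambda>j. T (2, j)) ` {1..n}}"
    unfolding descents_def by (force simp: image_iff)
  then show ?thesis by (simp add: maj_def row_sets_def pair_maj_def)
qed

section \<open>The generating function over arrays\<close>

theorem theorem1p3:
  fixes n k :: nat
  assumes "n \<ge> 1" and "k \<le> n"
  shows "(\<Sum>T\<in>RInc k n. qvar ^ maj n T) =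
    qvar powi (int n + (int k * (int k - 3)) div 2) / qnum qvar (n - k + 1)
      * qbinom qvar (2 * n - k) k * qbinom qvar (2 * n - 2 * k) (n - k)"
proof -
  have "(\<Sum>T\<in>RInc k n. qvar ^ maj n T) =
      (\<Sum>T\<in>RInc k n. (\<lambda>(A, B). qvar ^ pair_maj A B) (row_sets n T))"
    by (simp add: maj_eq_pair_maj case_prod_beta)
  also have "\<dots> = maj_sum qvar (n - k) (n - k) k"
    unfolding maj_sum_def by (rule sum.reindex_bij_betw[OF bij_betw_row_sets[OF assms(2)]])
  also have "\<dots> = ballot_sum qvar (n - k) (n - k) k"
    using maj_sum_eq_ballot_sum[OF qnum_qvar_nonzero] by simp
  also have "\<dots> = qvar ^ (n - k + (k choose 2)) / qnum qvar (n - k + 1)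
      * qbinom qvar (2 * (n - k) + k) k * qbinom qvar (2 * (n - k)) (n - k)"
    by (rule ballot_sum_diagonal[OF qnum_qvar_nonzero])
  also have "2 * (n - k) + k = 2 * n - k" using assms(2) by simp
  also have "2 * (n - k) = 2 * n - 2 * k" by simp
  \<comment> \<open>The summand \<open>k (k - 3) / 2\<close> is -1 for \<open>k = 1\<close> and
    \<open>k = 2\<close>, hence the integer exponent; adding \<open>k\<close> to it gives
    \<open>k choose 2\<close>, so the whole exponent is a natural number.\<close>
  also have "qvar ^ (n - k + (k choose 2)) = qvar powi (int n + (int k * (int k - 3)) div 2)"
  proof -
    have "int (k choose 2) = (int k * (int k - 1)) div 2"
      by (cases k) (simp_all add: choose_two zdiv_int algebra_simps)
    also have "int k * (int k - 1) = int k * (int k - 3) + int k * 2"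
      by (simp add: algebra_simps)
    also have "\<dots> div 2 = int k * (int k - 3) div 2 + int k" by simp
    finally have "int (n - k + (k choose 2)) = int n + (int k * (int k - 3)) div 2"
      using assms(2) by simp
    then show ?thesis by (metis power_int_of_nat)
  qed
  finally show ?thesis .
qed

end
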